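(* Let $n,r\ge 1$ and $k\ge 1$ be integers. Let $m^{(1)},\dots,m^{(k)}\in\mathbb{C}[x]$ be pairwise coprime polynomials of degree at least $1$ such that $M=\prod_{i=1}^k m^{(i)}$ satisfies $\deg M=n+r-1$. For each $i\in\{1,\dots,k\}$ let $(A^{(i)},B^{(i)},C^{(i)})$ be a bilinear algorithm for linear convolution of two vectors of dimension $\deg m^{(i)}$. Let $M^{(i)}=M/m^{(i)}$, let $N^{(i)},n^{(i)}\in\mathbb{C}[x]$ be polynomials with $M^{(i)}N^{(i)}+m^{(i)}n^{(i)}=1$, and let $e^{(i)}=M^{(i)}N^{(i)}\bmod M$. Define $$A=\begin{bmatrix} X_{\langle m^{(1)},r-1\rangle}^{\mathsf T}A^{(1)} & \cdots & X_{\langle m^{(k)},r-1\rangle}^{\mathsf T}A^{(k)}\end{bmatrix},$$ $$B=\begin{bmatrix} X_{\langle m^{(1)},n-1\rangle}^{\mathsf T}B^{(1)} & \cdots & X_{\langle m^{(k)},n-1\rangle}^{\mathsf T}B^{(k)}\end{bmatrix},$$ $$C=\begin{bmatrix}\tilde C^{(1)} & \cdots & \tilde C^{(k)}\end{bmatrix},$$ where $$\tilde C^{(i)}=X_{\langle M,\deg M+\deg m^{(i)}-2\rangle}\;T_{\langle e^{(i)},\deg m^{(i)}\rangle}\;X_{\langle m^{(i)},2\deg m^{(i)}-2\rangle}\;C^{(i)} .$$ Then $(A,B,C)$ is a bilinear algorithm for linear convolution of vectors of dimension $r$ and $n$, i.e. $f*g=C\big[(A^{\mathsf T}f)\odot(B^{\mathsf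 T}g)\big]$ for all $f\in\mathbb{C}^r$ and $g\in\mathbb{C}^n$.
   Context: Linear convolution: for $f\in\mathbb{C}^r$, $g\in\mathbb{C}^n$ (indices from $0$), $f*g\in\mathbb{C}^{n+r-1}$ has entries $(f*g)_k=\sum_i f_i g_{k-i}$, the sum over all $i$ with $0\le i\le r-1$ and $0\le k-i\le n-1$. Bilinear algorithm: matrices $A\in\mathbb{C}^{r\times R}$, $B\in\mathbb{C}^{n\times R}$, $C\in\mathbb{C}^{(n+r-1)\times R}$ (for some $R$) form a bilinear algorithm for linear convolution of vectors of dimension $r$ and $n$ if $f*g=C[(A^{\mathsf T}f)\odot(B^{\mathsf T}g)]$ for all $f,g$, where $\odot$ is the entrywise product and $^{\mathsf T}$ is the (non-conjugated) transpose. A bilinear algorithm for vectors of dimension $s$ is the case $r=n=s$. Coefficient vectors list coefficients in ascending order of degree. A remainder modulo a polynomial $m$ is the unique representative of degree less than $\deg m$, and its coefficient vector is zero-padded to length $\deg m$; in particular the coefficient vector of $e^{(i)}$ has length $\deg M$. Toeplitz matrix: for $v=(v_0,\dots,v_{s-1})$, $T_{\langle v,t\rangle}\in\mathbb{C}^{(s+t-1)\times t}$ has $(a,b)$ entry $v_{a-b}$ if $0\le a-b\le s-1$ and $0$ otherwise (so $T_{\langle v,t\rangle}w=v*w$ for $w\in\mathbb{C}^t$). For a polynomial, $T_{\langle\cdot,t\rangle}$ is formed from its coefficient vector. Modular reduction matrix: for a polynomial $m$ of degree $\deg m\geq 1$ (coefficient vector of length $\deg m+1$) and an integer $d\ge \deg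 m-1$, $X_{\langle m,d\rangle}=\begin{bmatrix} I & -LU^{-1}\end{bmatrix}\in\mathbb{C}^{\deg m\times(d+1)}$, where $I$ is the identity of size $\deg m$, $L$ consists of the top $\deg m$ rows and $U$ of the bottom $d-\deg m+1$ rows of $T_{\langle m,d-\deg m+1\rangle}$ (for $d=\deg m-1$ the second block is empty). For $0\le d<\deg m-1$, $X_{\langle m,d\rangle}$ denotes the first $d+1$ columns of the identity matrix of size $\deg m$ (zero-padding). *)

theory Defs
  imports
    "HOL-Computational_Algebra.Computational_Algebra"
    "Jordan_Normal_Form.Gauss_Jordan_Elimination"
begin

definition lin_conv :: "complex vec \<Rightarrow> complex vec \<Rightarrow> complex vec" where
  "lin_conv f g = vec (dim_vec g + dim_vec f - 1)
     (\<lambda>k. \<Sum>i \<in> {i. i < dim_vec f \<and> i \<le> k \<and> k - i < dim_vec g}. f $ i * g $ (k - i))"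

text \<open>Since \<open>A\<close> and \<open>B\<close> have the same number of columns, the truncation to the shorter argument
  in \<^const>\<open>component_mult\<close> is vacuous here.\<close>

definition bilinear_algorithm ::
    "nat \<Rightarrow> nat \<Rightarrow> complex mat \<Rightarrow> complex mat \<Rightarrow> complex mat \<Rightarrow> bool" where
  "bilinear_algorithm r n A B C \<longleftrightarrow>
     (\<exists>R. A \<in> carrier_mat r R \<and> B \<in> carrier_mat n R \<and> C \<in> carrier_mat (n + r - 1) R) \<and>
     (\<forall>f \<in> carrier_vec r. \<forall>g \<in> carrier_vec n.
        lin_conv f g =
          C *\<^sub>v component_mult (transpose_mat A *\<^sub>v f) (transpose_mat B *\<^sub>v g))"

definition coeff_vec :: "nat \<Rightarrow> complex poly \<Rightarrow> complex vec" where
  "coeff_vec l p = vec l (coeff p)"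

definition toeplitz :: "complex vec \<Rightarrow> nat \<Rightarrow> complex mat" where
  "toeplitz v t = mat (dim_vec v + t - 1) t
     (\<lambda>(a, b). if b \<le> a \<and> a - b < dim_vec v then v $ (a - b) else 0)"

text \<open>The number \<open>h\<close> of rows is explicit so that an empty list of blocks is covered.\<close>

definition hconcat :: "nat \<Rightarrow> complex mat list \<Rightarrow> complex mat" where
  "hconcat h Fs = mat_of_cols h (concat (map cols Fs))"

text \<open>In the first case \<open>U\<close> is triangular with the leading coefficient of \<open>m\<close> on its diagonal, so
  \<^const>\<open>mat_inverse\<close> does return an inverse when \<open>m \<noteq> 0\<close>. If \<open>d + 1 = degree m\<close>, then \<open>t = 0\<close> and
  the second block has no columns.\<close>

definition mod_reduction_mat :: "complex poly \<Rightarrow> nat \<Rightarrow> complex mat" where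
  "mod_reduction_mat m d =
     (if degree m \<le> d + 1 then
        let t = d + 1 - degree m;
            T = toeplitz (coeff_vec (degree m + 1) m) t;
            L = mat (degree m) t (\<lambda>(a, b). T $$ (a, b));
            U = mat t t (\<lambda>(a, b). T $$ (degree m + a, b))
        in hconcat (degree m) [1\<^sub>m (degree m), - (L * the (mat_inverse U))]
      else mat (degree m) (d + 1) (\<lambda>(a, b). 1\<^sub>m (degree m) $$ (a, b)))"

end

theory Submission
  imports Defs "HOL-Computational_Algebra.Field_as_Ring" "Jordan_Normal_Form.Determinant"
begin

text \<open>
  Read every vector as the coefficient vector of a polynomial. Then linear convolution is
  multiplication of polynomials (\<open>lin_conv_coeff_vec\<close>), a Toeplitz matrix multiplies by a fixed
  polynomial (\<open>toeplitz_mult_coeff_vec\<close>), and \<open>X\<^bsub>\<langle>m,d\<rangle>\<^esub>\<close> takes remainders modulo \<open>m\<close>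
  (\<open>mod_reduction_mat_mult_coeff_vec\<close>).

  Let \<open>f\<close> and \<open>g\<close> come from polynomials \<open>p\<close> and \<open>q\<close> of degrees below \<open>r\<close> and \<open>n\<close>. The concatenated
  matrices act block by block, so the output is the sum over \<open>i\<close> of what the \<open>i\<close>-th blocks compute
  (\<open>hconcat_bilinear_sum\<close>). The \<open>i\<close>-th blocks of \<open>A\<close> and \<open>B\<close> feed \<open>p mod m\<^sub>i\<close> and \<open>q mod m\<^sub>i\<close>
  into the \<open>i\<close>-th small algorithm, which multiplies them. The remaining factors of the \<open>i\<close>-th block of
  \<open>C\<close> reduce this product modulo \<open>m\<^sub>i\<close>, which gives \<open>p q mod m\<^sub>i\<close>, multiply by \<open>e\<^sub>i\<close>, and
  reduce modulo \<open>M\<close>.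

  Now \<open>e\<^sub>i\<close> is congruent to \<open>1\<close> modulo \<open>m\<^sub>i\<close> and to \<open>0\<close> modulo the other moduli, so the sum of
  these blocks is congruent to \<open>p q\<close> modulo every \<open>m\<^sub>i\<close>, hence modulo \<open>M\<close>. Since
  \<open>deg (p q) \<le> n + r - 2 < deg M\<close>, it equals \<open>p q\<close> (\<open>chinese_remainder_reconstruction\<close>).
\<close>

no_notation fps_nth (infixl "$" 75)

section \<open>Coefficient vectors\<close>

lemma coeff_vec_carrier [simp]: "coeff_vec l p \<in> carrier_vec l"
  and dim_coeff_vec [simp]: "dim_vec (coeff_vec l p) = l"
  and index_coeff_vec [simp]: "i < l \<Longrightarrow> coeff_vec l p $ i = coeff p i"
  by (simp_all add: coeff_vec_def)

lemma coeff_vec_add: "coeff_vec l (p + q) = coeff_vec l p + coeff_vec l q"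
  by (rule eq_vecI) auto

text \<open>The bound \<open>l \<ge> 1\<close> is there because the zero polynomial has degree \<open>0\<close>, which is not below an
  empty length.\<close>

lemma carrier_vec_eq_coeff_vec:
  assumes "v \<in> carrier_vec l" "l \<ge> 1"
  obtains p where "degree p < l" "v = coeff_vec l p"
proof
  let ?p = "Poly (list_of_vec v)"
  show "v = coeff_vec l ?p"
    using assms(1) by (intro eq_vecI) (auto simp: nth_default_def list_of_vec_index)
  show "degree ?p < l"
    using assms by (intro le_less_trans[OF degree_le[of "l - 1"]])
      (auto simp: nth_default_def)
qed

lemma lin_conv_coeff_vec:
  assumes "degree p < r" "degree q < n"
  shows "lin_conv (coeff_vec r p) (coeff_vec n q) = coeff_vec (n + r - 1) (p * q)"
proof (rule eq_vecI)
  fix k assume k: "k < dim_vec (coeff_vec (n + r - 1) (p * q))"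
  have "(\<Sum>i \<in> {i. i < r \<and> i \<le> k \<and> k - i < n}. coeff_vec r p $ i * coeff_vec n q $ (k - i))
      = (\<Sum>i\<le>k. coeff p i * coeff q (k - i))"
    using assms le_degree[of p] le_degree[of q]
    by (intro sum.mono_neutral_cong_left) (auto intro: le_less_trans)
  then show "lin_conv (coeff_vec r p) (coeff_vec n q) $ k = coeff_vec (n + r - 1) (p * q) $ k"
    using k by (simp add: lin_conv_def coeff_mult)
qed (simp add: lin_conv_def)

lemma toeplitz_carrier: "toeplitz v t \<in> carrier_mat (dim_vec v + t - 1) t"
  by (simp add: toeplitz_def)

text \<open>The disjunct \<open>q = 0\<close> makes the lemma usable for \<open>t = 0\<close>, the matrix without columns; this is
  the case of a modular reduction in which the quotient vanishes.\<close>

lemma toeplitz_mult_coeff_vec: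
  assumes "degree p < s" "q = 0 \<or> degree q < t"
  shows "toeplitz (coeff_vec s p) t *\<^sub>v coeff_vec t q = coeff_vec (s + t - 1) (p * q)"
proof (rule eq_vecI)
  fix a assume "a < dim_vec (coeff_vec (s + t - 1) (p * q))"
  then have a: "a < s + t - 1" by simp
  have "(\<Sum>b = 0..<t. (if b \<le> a \<and> a - b < s then coeff_vec s p $ (a - b) else 0) * coeff q b)
      = (\<Sum>b\<le>a. coeff q b * coeff p (a - b))"
    using assms by (intro sum.mono_neutral_cong) (auto simp: coeff_eq_0)
  then show "(toeplitz (coeff_vec s p) t *\<^sub>v coeff_vec t q) $ a = coeff_vec (s + t - 1) (p * q) $ a"
    using a by (simp add: toeplitz_def scalar_prod_def mult.commute[of p] coeff_mult)
qed (simp add: toeplitz_def)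

section \<open>Horizontal concatenation\<close>

lemma hconcat_map_carrier:
  assumes "\<And>i. i \<in> set is \<Longrightarrow> F i \<in> carrier_mat h (R i)"
  shows "hconcat h (map F is) \<in> carrier_mat h (\<Sum>i\<leftarrow>is. R i)"
proof -
  have "length (concat (map cols (map F is))) = (\<Sum>i\<leftarrow>is. R i)"
    using assms
  proof (induction "is")
    case (Cons i "is")
    have "dim_col (F i) = R i" using Cons.prems[of i] by simp
    with Cons show ?case by simp
  qed simp
  then show ?thesis by (metis hconcat_def mat_of_cols_carrier(1))
qed

lemma hconcat_Nil: "hconcat h [] = 0\<^sub>m h 0"
  by (rule eq_matI) (auto simp: hconcat_def)

text \<open>The entrywise form of a concatenation: all later facts about the action of a concatenation on
  vectors peel off one block with it.\<close>

lemma hconcat_Cons: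
  assumes "F \<in> carrier_mat h c"
  shows "hconcat h (F # Fs) = mat h (c + dim_col (hconcat h Fs))
    (\<lambda>(i, j). if j < c then F $$ (i, j) else hconcat h Fs $$ (i, j - c))"
  using assms by (intro eq_matI) (auto simp: hconcat_def mat_of_cols_index nth_append)

lemma hconcat_Cons_mult_append:
  assumes F: "F \<in> carrier_mat h c" and u: "u \<in> carrier_vec c"
    and w: "w \<in> carrier_vec (dim_col (hconcat h Fs))"
  shows "hconcat h (F # Fs) *\<^sub>v (u @\<^sub>v w) = F *\<^sub>v u + hconcat h Fs *\<^sub>v w"
proof (rule eq_vecI)
  have dr: "dim_row (hconcat h Fs) = h" by (simp add: hconcat_def)
  fix i assume "i < dim_vec (F *\<^sub>v u + hconcat h Fs *\<^sub>v w)"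
  then have i: "i < h" using dr by simp
  have "row (hconcat h (F # Fs)) i = row F i @\<^sub>v row (hconcat h Fs) i"
    using i F dr by (intro eq_vecI) (auto simp: hconcat_Cons[OF F])
  then show "(hconcat h (F # Fs) *\<^sub>v (u @\<^sub>v w)) $ i = (F *\<^sub>v u + hconcat h Fs *\<^sub>v w) $ i"
    using i F u w dr
    by (simp add: hconcat_Cons[OF F]
        scalar_prod_append[of _ c _ "dim_col (hconcat h Fs)"])
qed (use F in \<open>simp add: hconcat_def\<close>)

lemma transpose_hconcat_Cons_mult:
  assumes F: "F \<in> carrier_mat h c" and f: "f \<in> carrier_vec h"
  shows "transpose_mat (hconcat h (F # Fs)) *\<^sub>v f
    = (transpose_mat F *\<^sub>v f) @\<^sub>v (transpose_mat (hconcat h Fs) *\<^sub>v f)"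
proof (rule eq_vecI)
  have dr: "dim_row (hconcat h Fs) = h" by (simp add: hconcat_def)
  fix j assume "j < dim_vec ((transpose_mat F *\<^sub>v f) @\<^sub>v (transpose_mat (hconcat h Fs) *\<^sub>v f))"
  then have j: "j < c + dim_col (hconcat h Fs)" using F by simp
  have "col (hconcat h (F # Fs)) j
    = (if j < c then col F j else col (hconcat h Fs) (j - c))"
    using j F dr by (intro eq_vecI) (auto simp: hconcat_Cons[OF F])
  then show "(transpose_mat (hconcat h (F # Fs)) *\<^sub>v f) $ j
      = ((transpose_mat F *\<^sub>v f) @\<^sub>v (transpose_mat (hconcat h Fs) *\<^sub>v f)) $ j"
    using j F by (auto simp: hconcat_Cons[OF F])
qed (use F in \<open>simp add: hconcat_Cons[OF F]\<close>)

lemma component_mult_append: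
  assumes "dim_vec u = dim_vec u'" "dim_vec w = dim_vec w'"
  shows "component_mult (u @\<^sub>v w) (u' @\<^sub>v w') = component_mult u u' @\<^sub>v component_mult w w'"
  using assms by (intro eq_vecI) (auto simp: component_mult_def)

text \<open>Transposed concatenations stack the vectors that their blocks produce, entrywise products respect
  the stacking because paired blocks have the same number \<open>R i\<close> of columns, and the outer
  concatenation adds the contributions of the stacked parts. So a bilinear algorithm built from
  blocks computes the sum of what the blocks compute, here recorded as coefficient vectors.\<close>

lemma hconcat_bilinear_sum:
  assumes f: "f \<in> carrier_vec r" and g: "g \<in> carrier_vec n"
    and blocks: "\<And>i. i \<in> set is \<Longrightarrow> F i \<in> carrier_mat r (R i)"
      "\<And>i. i \<in> set is \<Longrightarrow> G i \<in> carrier_mat n (R i)"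
      "\<And>i. i \<in> set is \<Longrightarrow> H i \<in> carrier_mat h (R i)"
    and val: "\<And>i. i \<in> set is \<Longrightarrow>
      H i *\<^sub>v component_mult (transpose_mat (F i) *\<^sub>v f) (transpose_mat (G i) *\<^sub>v g)
        = coeff_vec h (p i)"
  shows "hconcat h (map H is) *\<^sub>v
      component_mult (transpose_mat (hconcat r (map F is)) *\<^sub>v f)
        (transpose_mat (hconcat n (map G is)) *\<^sub>v g)
    = coeff_vec h (\<Sum>i\<leftarrow>is. p i)"
  using blocks val
proof (induction "is")
  case Nil
  then show ?case
    by (intro eq_vecI) (auto simp: hconcat_Nil component_mult_def scalar_prod_def)
next
  case (Cons i "is")
  have cF: "F i \<in> carrier_mat r (R i)" and cG: "G i \<in> carrier_mat n (R i)"
    and cH: "H i \<in> carrier_mat h (R i)"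
    using Cons.prems by auto
  have dims: "dim_col (hconcat r (map F is)) = (\<Sum>i\<leftarrow>is. R i)"
    "dim_col (hconcat n (map G is)) = (\<Sum>i\<leftarrow>is. R i)"
    "dim_col (hconcat h (map H is)) = (\<Sum>i\<leftarrow>is. R i)"
    by (rule carrier_matD(2)[OF hconcat_map_carrier]; simp add: Cons.prems)+
  have IH: "hconcat h (map H is) *\<^sub>v
      component_mult (transpose_mat (hconcat r (map F is)) *\<^sub>v f)
        (transpose_mat (hconcat n (map G is)) *\<^sub>v g)
    = coeff_vec h (\<Sum>i\<leftarrow>is. p i)"
    using Cons.prems by (intro Cons.IH) auto
  define u where "u = transpose_mat (F i) *\<^sub>v f"
  define u' where "u' = transpose_mat (G i) *\<^sub>v g"
  define w where "w = transpose_mat (hconcat r (map F is)) *\<^sub>v f"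
  define w' where "w' = transpose_mat (hconcat n (map G is)) *\<^sub>v g"
  have u: "dim_vec u = R i" "dim_vec u' = R i"
    using cF cG by (simp_all add: u_def u'_def)
  have w: "dim_vec w = (\<Sum>i\<leftarrow>is. R i)" "dim_vec w' = (\<Sum>i\<leftarrow>is. R i)"
    by (simp_all add: w_def w'_def dims)
  have "component_mult (transpose_mat (hconcat r (map F (i # is))) *\<^sub>v f)
        (transpose_mat (hconcat n (map G (i # is))) *\<^sub>v g)
    = component_mult (u @\<^sub>v w) (u' @\<^sub>v w')"
    by (simp only: list.map transpose_hconcat_Cons_mult[OF cF f]
        transpose_hconcat_Cons_mult[OF cG g] u_def u'_def w_def w'_def)
  also have "\<dots> = component_mult u u' @\<^sub>v component_mult w w'"
    using u w by (simp add: component_mult_append)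
  also have "hconcat h (map H (i # is)) *\<^sub>v \<dots>
      = H i *\<^sub>v component_mult u u' + hconcat h (map H is) *\<^sub>v component_mult w w'"
    unfolding list.map
    by (rule hconcat_Cons_mult_append[OF cH]; rule carrier_vecI; simp only: dim_component_mult u w dims min.idem)
  also have "H i *\<^sub>v component_mult u u' = coeff_vec h (p i)"
    using Cons.prems(4)[of i] by (simp add: u_def u'_def)
  also have "hconcat h (map H is) *\<^sub>v component_mult w w' = coeff_vec h (\<Sum>i\<leftarrow>is. p i)"
    using IH by (simp only: w_def w'_def)
  finally show ?case by (simp add: coeff_vec_add)
qed

section \<open>Modular reduction\<close>

text \<open>The lower block of the Toeplitz matrix of \<open>m\<close> starts at the row of the leading coefficient. It is
  therefore upper triangular with \<open>lead_coeff m\<close> along the diagonal, so its determinant is a power of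
  a nonzero number. For \<open>t = 0\<close> this is the empty determinant \<open>1\<close>.\<close>

lemma toeplitz_lower_block_inverse:
  fixes m :: "complex poly" and t :: nat
  assumes "m \<noteq> 0"
  defines "U \<equiv> mat t t (\<lambda>(a, b). toeplitz (coeff_vec (degree m + 1) m) t $$ (degree m + a, b))"
  shows "the (mat_inverse U) \<in> carrier_mat t t" "the (mat_inverse U) * U = 1\<^sub>m t"
proof -
  have U: "U \<in> carrier_mat t t" by (simp add: U_def)
  have "upper_triangular U"
    by (auto simp: U_def toeplitz_def)
  moreover have "diag_mat U = replicate t (lead_coeff m)"
    by (rule nth_equalityI) (auto simp: U_def toeplitz_def diag_mat_def)
  ultimately have "det U = lead_coeff m ^ t"
    using det_upper_triangular[OF _ U] by simp
  then have "det U \<noteq> 0" using assms(1) by simp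
  then have "U \<in> Units (ring_mat TYPE(complex) t ())" by (rule det_non_zero_imp_unit[OF U])
  then obtain V where "mat_inverse U = Some V"
    using mat_inverse(1)[OF U, of "()"] by (cases "mat_inverse U") blast+
  then show "the (mat_inverse U) \<in> carrier_mat t t" "the (mat_inverse U) * U = 1\<^sub>m t"
    using mat_inverse(2)[OF U] by auto
qed

lemma mod_reduction_mat_carrier:
  assumes "m \<noteq> 0"
  shows "mod_reduction_mat m d \<in> carrier_mat (degree m) (d + 1)"
proof (cases "degree m \<le> d + 1")
  case True
  define t where "t = d + 1 - degree m"
  define T where "T = toeplitz (coeff_vec (degree m + 1) m) t"
  define L where "L = mat (degree m) t (\<lambda>(a, b). T $$ (a, b))"
  define V where "V = the (mat_inverse (mat t t (\<lambda>(a, b). T $$ (degree m + a, b))))"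
  have X: "mod_reduction_mat m d = hconcat (degree m) [1\<^sub>m (degree m), - (L * V)]"
    using True by (simp only: mod_reduction_mat_def Let_def t_def T_def L_def V_def if_True)
  have "V \<in> carrier_mat t t"
    unfolding V_def T_def by (rule toeplitz_lower_block_inverse(1)[OF assms])
  then have "dim_col (- (L * V)) = t" by simp
  moreover have "d + 1 = degree m + t" using True by (simp add: t_def)
  moreover have "F \<in> carrier_mat (degree m) (dim_col F)"
    if "F \<in> set [1\<^sub>m (degree m), - (L * V)]" for F
    using that by (auto simp: L_def)
  then have "hconcat (degree m) (map (\<lambda>F. F) [1\<^sub>m (degree m), - (L * V)])
      \<in> carrier_mat (degree m) (\<Sum>F\<leftarrow>[1\<^sub>m (degree m), - (L * V)]. dim_col F)"
    by (rule hconcat_map_carrier)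
  ultimately show ?thesis
    by (simp add: X)
qed (simp add: mod_reduction_mat_def)

text \<open>Polynomial division as linear algebra. Write \<open>p = m q + s\<close> with \<open>s = p mod m\<close>, and let \<open>x\<close> be the
  coefficient vector of \<open>q\<close>. Since \<open>s\<close> has degree below \<open>degree m\<close>, the coefficients of \<open>p\<close> from
  \<open>degree m\<close> upwards are those of \<open>m q\<close>, that is \<open>y = U x\<close>; this determines \<open>x = U\<^sup>-\<^sup>1 y\<close>. The lower
  coefficients of \<open>m q\<close> are \<open>L x = L U\<^sup>-\<^sup>1 y\<close>, and subtracting them from those of \<open>p\<close> leaves \<open>s\<close>.\<close>

lemma mod_reduction_mat_mult_coeff_vec:
  assumes m: "m \<noteq> 0" and p: "degree p < d + 1"
  shows "mod_reduction_mat m d *\<^sub>v coeff_vec (d + 1) p = coeff_vec (degree m) (p mod m)"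
proof (cases "degree m \<le> d + 1")
  \<comment> \<open>Here \<open>X\<close> only pads with zeros, and \<open>p\<close> is its own remainder.\<close>
  case False
  then have "p mod m = p" using p by (intro mod_poly_less) simp
  moreover have "mod_reduction_mat m d *\<^sub>v coeff_vec (d + 1) p = coeff_vec (degree m) p"
  proof (rule eq_vecI)
    fix a assume "a < dim_vec (coeff_vec (degree m) p)"
    then have a: "a < degree m" by simp
    have "(\<Sum>b = 0..<d + 1. 1\<^sub>m (degree m) $$ (a, b) * coeff p b)
        = (\<Sum>b = 0..<d + 1. if b = a then coeff p b else 0)"
      using a False by (intro sum.cong) auto
    also have "\<dots> = coeff p a"
      using p by (auto simp: coeff_eq_0)
    finally show "(mod_reduction_mat m d *\<^sub>v coeff_vec (d + 1) p) $ a = coeff_vec (degree m) p $ a"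
      using a False by (simp add: mod_reduction_mat_def scalar_prod_def)
  qed (use False in \<open>simp add: mod_reduction_mat_def\<close>)
  ultimately show ?thesis by simp
next
  case True
  define t where "t = d + 1 - degree m"
  define T where "T = toeplitz (coeff_vec (degree m + 1) m) t"
  define L where "L = mat (degree m) t (\<lambda>(a, b). T $$ (a, b))"
  define U where "U = mat t t (\<lambda>(a, b). T $$ (degree m + a, b))"
  define V where "V = the (mat_inverse U)"
  define q where "q = p div m"
  define x where "x = coeff_vec t q"
  define y where "y = vec t (\<lambda>a. coeff p (degree m + a))"
  have d: "d + 1 = degree m + t" using True by (simp add: t_def)
  have X: "mod_reduction_mat m d = hconcat (degree m) [1\<^sub>m (degree m), - (L * V)]"
    using True by (simp only: mod_reduction_mat_def Let_def t_def T_def L_def U_def V_def if_True)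
  have L: "L \<in> carrier_mat (degree m) t" and U: "U \<in> carrier_mat t t"
    and x: "x \<in> carrier_vec t" and y: "y \<in> carrier_vec t"
    by (simp_all add: L_def U_def x_def y_def)
  have V: "V \<in> carrier_mat t t" and VU: "V * U = 1\<^sub>m t"
    using toeplitz_lower_block_inverse[OF m, of t] by (simp_all add: V_def U_def T_def)
  have "q = 0 \<or> degree q < t"
  proof (cases "q = 0")
    case False
    have "degree (p mod m) < d + 1"
      using degree_mod_less[OF m, of p] True by auto
    then have "degree (p - p mod m) < d + 1" by (intro degree_diff_less p)
    then have "degree (m * q) < d + 1" by (simp add: q_def minus_mod_eq_mult_div)
    then show ?thesis using m False d by (simp add: degree_mult_eq)
  qed simp
  then have "T *\<^sub>v x = coeff_vec (d + 1) (m * q)"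
    using toeplitz_mult_coeff_vec[of m "degree m + 1" q t] by (simp only: T_def x_def d) simp
  then have Tx: "(T *\<^sub>v x) $ a = coeff (m * q) a" if "a < d + 1" for a
    using that by simp
  have T: "T \<in> carrier_mat (d + 1) t"
    using toeplitz_carrier[of "coeff_vec (degree m + 1) m" t] by (simp add: T_def d[simplified])
  have Lx: "(L *\<^sub>v x) $ a = coeff (m * q) a" if "a < degree m" for a
  proof -
    have "row L a = row T a" using that T d by (intro eq_vecI) (auto simp: L_def)
    then show ?thesis using that L T d Tx[of a] by simp
  qed
  have Ux: "(U *\<^sub>v x) $ a = coeff (m * q) (degree m + a)" if "a < t" for a
  proof -
    have "row U a = row T (degree m + a)" using that T d by (intro eq_vecI) (auto simp: U_def)
    then show ?thesis using that U T d Tx[of "degree m + a"] by simp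
  qed
  have p_eq: "coeff p a = coeff (m * q) a + coeff (p mod m) a" for a
    unfolding q_def coeff_add[symmetric] mult_div_mod_eq ..
  have high: "coeff (p mod m) (degree m + a) = 0" for a
    using degree_mod_less[OF m, of p] by (auto simp: coeff_eq_0)
  have "y = U *\<^sub>v x"
    by (intro eq_vecI) (use U Ux high p_eq in \<open>simp_all add: y_def\<close>)
  then have "V *\<^sub>v y = x"
    using assoc_mult_mat_vec[OF V U x] VU x by simp
  then have LVy: "(L * V) *\<^sub>v y = L *\<^sub>v x"
    using L V y by simp
  have split: "coeff_vec (d + 1) p = coeff_vec (degree m) p @\<^sub>v y"
    unfolding d by (rule eq_vecI) (auto simp: y_def)
  have one: "hconcat (degree m) [- (L * V)] = - (L * V)"
    using L mat_of_cols_cols[of "- (L * V)"] by (simp add: hconcat_def)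
  have "mod_reduction_mat m d *\<^sub>v coeff_vec (d + 1) p = coeff_vec (degree m) p + (- (L * V)) *\<^sub>v y"
    using hconcat_Cons_mult_append[of "1\<^sub>m (degree m)" "degree m" "degree m"
        "coeff_vec (degree m) p" y "[- (L * V)]"] V y
    by (simp add: X split[simplified] one)
  also have "\<dots> = coeff_vec (degree m) (p mod m)"
  proof (rule eq_vecI)
    fix a assume "a < dim_vec (coeff_vec (degree m) (p mod m))"
    then have a: "a < degree m" by simp
    have "((- (L * V)) *\<^sub>v y) $ a = - ((L * V) *\<^sub>v y) $ a"
      using a L V y by (simp add: uminus_mult_mat_vec)
    then show "(coeff_vec (degree m) p + (- (L * V)) *\<^sub>v y) $ a = coeff_vec (degree m) (p mod m) $ a"
      using a L V by (simp add: LVy Lx p_eq del: index_mult_mat_vec)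
  qed (use L in simp)
  finally show ?thesis .
qed

section \<open>Chinese remaindering\<close>

text \<open>By induction, as each factor is coprime to the product of the others.\<close>

lemma pairwise_coprime_prod_dvd:
  fixes m :: "'b \<Rightarrow> 'a::semiring_gcd"
  assumes "finite S" "\<And>i j. i \<in> S \<Longrightarrow> j \<in> S \<Longrightarrow> i \<noteq> j \<Longrightarrow> coprime (m i) (m j)"
    and "\<And>i. i \<in> S \<Longrightarrow> m i dvd a"
  shows "(\<Prod>i\<in>S. m i) dvd a"
  using assms
proof (induction S rule: finite_induct)
  case (insert i S)
  have "coprime (m i) (\<Prod>j\<in>S. m j)"
    using insert.hyps insert.prems(1) by (intro prod_coprime_right) (metis insertCI)
  then show ?case using insert by (simp add: divides_mult)
qed simp

text \<open>Both sides have degree below \<open>degree M\<close>, so it suffices that \<open>M\<close> divides their difference, and by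
  coprimality that every \<open>m j\<close> does. Modulo \<open>m j\<close> a summand with \<open>i \<noteq> j\<close> vanishes because \<open>m j\<close> is a
  factor of \<open>M div m i\<close>, and the summand with \<open>i = j\<close> is \<open>s\<close> because the Bezout identity makes \<open>e j\<close>
  congruent to \<open>1\<close>. Reductions modulo \<open>M\<close> do no harm, since \<open>m j\<close> divides \<open>M\<close>.\<close>

lemma chinese_remainder_reconstruction:
  fixes m N n' e :: "'b \<Rightarrow> 'a::field_gcd poly"
  assumes fin: "finite S"
    and cop: "\<And>i j. i \<in> S \<Longrightarrow> j \<in> S \<Longrightarrow> i \<noteq> j \<Longrightarrow> coprime (m i) (m j)"
    and M: "M = (\<Prod>i\<in>S. m i)"
    and bezout: "\<And>i. i \<in> S \<Longrightarrow> (M div m i) * N i + m i * n' i = 1"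
    and e: "\<And>i. i \<in> S \<Longrightarrow> e i = ((M div m i) * N i) mod M"
    and s: "degree s < degree M"
  shows "(\<Sum>i\<in>S. (e i * (s mod m i)) mod M) = s"
proof -
  have M0: "M \<noteq> 0" using s by auto
  let ?t = "\<Sum>i\<in>S. (e i * (s mod m i)) mod M"
  have "M dvd ?t - s"
    unfolding M
  proof (rule pairwise_coprime_prod_dvd[OF fin cop])
    fix j assume j: "j \<in> S"
    have mM: "m i dvd M" if "i \<in> S" for i using that fin by (simp add: M dvd_prodI)
    have other: "m j dvd (e i * (s mod m i)) mod M" if i: "i \<in> S" "i \<noteq> j" for i
    proof -
      have mi0: "m i \<noteq> 0" using M0 mM[OF i(1)] by auto
      have "M = m i * (\<Prod>l\<in>S - {i}. m l)" unfolding M by (rule prod.remove[OF fin i(1)])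
      then have "M div m i = (\<Prod>l\<in>S - {i}. m l)" using mi0 by simp
      moreover have "m j dvd (\<Prod>l\<in>S - {i}. m l)" using fin i j by (intro dvd_prodI) auto
      ultimately have "m j dvd M div m i" by simp
      then show ?thesis using mM[OF j] e[OF i(1)] by (simp add: dvd_mod)
    qed
    have own: "m j dvd (e j * (s mod m j)) mod M - s"
    proof -
      have "((e j * (s mod m j)) mod M) mod m j = (e j * s) mod m j"
        using mM[OF j] by (simp add: mod_mod_cancel mod_mult_right_eq)
      also have "\<dots> = (((M div m j) * N j) mod m j * s) mod m j"
        using mM[OF j] e[OF j] by (metis mod_mod_cancel mod_mult_left_eq)
      also have "((M div m j) * N j) mod m j = 1 mod m j"
        using bezout[OF j] by (metis mod_mult_self2)
      finally show ?thesis by (simp add: mod_eq_dvd_iff mod_mult_left_eq)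
    qed
    have "?t - s = ((e j * (s mod m j)) mod M - s) + (\<Sum>i\<in>S - {j}. (e i * (s mod m i)) mod M)"
      using sum.remove[OF fin j, of "\<lambda>i. (e i * (s mod m i)) mod M"] by simp
    also have "m j dvd \<dots>" using own other by (intro dvd_add dvd_sum) auto
    finally show "m j dvd (\<Sum>i\<in>S. (e i * (s mod m i)) mod (\<Prod>i\<in>S. m i)) - s"
      by (simp only: M)
  qed
  then have "?t mod M = s mod M" by (simp add: mod_eq_dvd_iff)
  moreover have "degree ?t < degree M"
  proof (rule degree_sum_less)
    fix i
    show "degree ((e i * (s mod m i)) mod M) < degree M"
      using degree_mod_less[OF M0, of "e i * (s mod m i)"] s by auto
  qed (use s in simp)
  ultimately show ?thesis using s by (simp add: mod_poly_less)
qed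

section \<open>The composed algorithm\<close>

theorem theorem5p2:
  fixes n r k :: nat
    and m N n' Mi e :: "nat \<Rightarrow> complex poly"
    and M :: "complex poly"
    and As Bs Cs Ct :: "nat \<Rightarrow> complex mat"
    and A B C :: "complex mat"
  assumes "n \<ge> 1" and "r \<ge> 1" and "k \<ge> 1"
    and deg_m: "\<And>i. i \<in> {1..k} \<Longrightarrow> degree (m i) \<ge> 1"
    and coprime_m:
      "\<And>i j. i \<in> {1..k} \<Longrightarrow> j \<in> {1..k} \<Longrightarrow> i \<noteq> j \<Longrightarrow> coprime (m i) (m j)"
    and M: "M = (\<Prod>i = 1..k. m i)"
    and deg_M: "degree M = n + r - 1"
    and small: "\<And>i. i \<in> {1..k} \<Longrightarrow>
      bilinear_algorithm (degree (m i)) (degree (m i)) (As i) (Bs i) (Cs i)"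
    and Mi: "\<And>i. i \<in> {1..k} \<Longrightarrow> Mi i = M div m i"
    and bezout: "\<And>i. i \<in> {1..k} \<Longrightarrow> Mi i * N i + m i * n' i = 1"
    and e: "\<And>i. i \<in> {1..k} \<Longrightarrow> e i = (Mi i * N i) mod M"
    and A: "A = hconcat r
      (map (\<lambda>i. transpose_mat (mod_reduction_mat (m i) (r - 1)) * As i) [1..<k + 1])"
    and B: "B = hconcat n
      (map (\<lambda>i. transpose_mat (mod_reduction_mat (m i) (n - 1)) * Bs i) [1..<k + 1])"
    and Ct: "\<And>i. i \<in> {1..k} \<Longrightarrow> Ct i =
      mod_reduction_mat M (degree M + degree (m i) - 2)
        * toeplitz (coeff_vec (degree M) (e i)) (degree (m i))
        * mod_reduction_mat (m i) (2 * degree (m i) - 2)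
        * Cs i"
    and C: "C = hconcat (n + r - 1) (map Ct [1..<k + 1])"
  shows "bilinear_algorithm r n A B C"
proof -
  have M0: "M \<noteq> 0" using deg_M assms(1,2) by auto
  have m0: "m i \<noteq> 0" if "i \<in> {1..k}" for i using deg_m[OF that] by auto
  let ?F = "\<lambda>i. transpose_mat (mod_reduction_mat (m i) (r - 1)) * As i"
  let ?G = "\<lambda>i. transpose_mat (mod_reduction_mat (m i) (n - 1)) * Bs i"
  define R where "R i = dim_col (As i)" for i
  have cs: "As i \<in> carrier_mat (degree (m i)) (R i)" "Bs i \<in> carrier_mat (degree (m i)) (R i)"
    "Cs i \<in> carrier_mat (2 * degree (m i) - 1) (R i)" if "i \<in> {1..k}" for i
    using small[OF that] by (auto simp: bilinear_algorithm_def R_def mult_2)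
  have cX: "mod_reduction_mat (m i) (r - 1) \<in> carrier_mat (degree (m i)) r"
    "mod_reduction_mat (m i) (n - 1) \<in> carrier_mat (degree (m i)) n"
    "mod_reduction_mat (m i) (2 * degree (m i) - 2) \<in> carrier_mat (degree (m i)) (2 * degree (m i) - 1)"
    "mod_reduction_mat M (degree M + degree (m i) - 2)
      \<in> carrier_mat (n + r - 1) (degree M + degree (m i) - 1)"
    "toeplitz (coeff_vec (degree M) (e i)) (degree (m i))
      \<in> carrier_mat (degree M + degree (m i) - 1) (degree (m i))"
    if "i \<in> {1..k}" for i
  proof -
    show "mod_reduction_mat (m i) (r - 1) \<in> carrier_mat (degree (m i)) r"
      using mod_reduction_mat_carrier[OF m0[OF that], of "r - 1"] assms(2) by simp
    show "mod_reduction_mat (m i) (n - 1) \<in> carrier_mat (degree (m i)) n"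
      using mod_reduction_mat_carrier[OF m0[OF that], of "n - 1"] assms(1) by simp
    have "2 * degree (m i) - 2 + 1 = 2 * degree (m i) - 1" using deg_m[OF that] by simp
    then show "mod_reduction_mat (m i) (2 * degree (m i) - 2)
        \<in> carrier_mat (degree (m i)) (2 * degree (m i) - 1)"
      by (metis mod_reduction_mat_carrier[OF m0[OF that]])
    have "degree M + degree (m i) - 2 + 1 = degree M + degree (m i) - 1"
      using deg_m[OF that] deg_M assms(1,2) by simp
    then show "mod_reduction_mat M (degree M + degree (m i) - 2)
        \<in> carrier_mat (n + r - 1) (degree M + degree (m i) - 1)"
      by (metis mod_reduction_mat_carrier[OF M0] deg_M)
    show "toeplitz (coeff_vec (degree M) (e i)) (degree (m i))
        \<in> carrier_mat (degree M + degree (m i) - 1) (degree (m i))"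
      using toeplitz_carrier[of "coeff_vec (degree M) (e i)"] by simp
  qed
  have cF: "?F i \<in> carrier_mat r (R i)" and cG: "?G i \<in> carrier_mat n (R i)"
    and cH: "Ct i \<in> carrier_mat (n + r - 1) (R i)" if "i \<in> {1..k}" for i
    using cs[OF that] cX[OF that] by (auto simp: Ct[OF that])
  have ks: "set [1..<k + 1] = {1..k}" by auto
  have carriers: "A \<in> carrier_mat r (\<Sum>i\<leftarrow>[1..<k + 1]. R i)"
    "B \<in> carrier_mat n (\<Sum>i\<leftarrow>[1..<k + 1]. R i)"
    "C \<in> carrier_mat (n + r - 1) (\<Sum>i\<leftarrow>[1..<k + 1]. R i)"
    unfolding A B C by (rule hconcat_map_carrier, unfold ks, fact cF cG cH)+
  have "lin_conv f g = C *\<^sub>v component_mult (transpose_mat A *\<^sub>v f) (transpose_mat B *\<^sub>v g)"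
    if f: "f \<in> carrier_vec r" and g: "g \<in> carrier_vec n" for f g
  proof -
    obtain p where p: "degree p < r" "f = coeff_vec r p"
      using carrier_vec_eq_coeff_vec[OF f assms(2)] .
    obtain q where q: "degree q < n" "g = coeff_vec n q"
      using carrier_vec_eq_coeff_vec[OF g assms(1)] .
    have "degree (p * q) \<le> degree p + degree q" by (rule degree_mult_le)
    then have s: "degree (p * q) < degree M" using p(1) q(1) deg_M by simp
    \<comment> \<open>Evaluate the \<open>i\<close>-th block from the inside out: reduce, multiply by the small algorithm, reduce
      again, multiply by \<open>e i\<close>, reduce modulo \<open>M\<close>.\<close>
    have block: "Ct i *\<^sub>v component_mult (transpose_mat (?F i) *\<^sub>v f) (transpose_mat (?G i) *\<^sub>v g)
        = coeff_vec (n + r - 1) ((e i * ((p * q) mod m i)) mod M)" if i: "i \<in> {1..k}" for i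
    proof -
      define d where "d = degree (m i)"
      define a where "a = p mod m i"
      define b where "b = q mod m i"
      have d1: "d \<ge> 1" using deg_m[OF i] by (simp add: d_def)
      have rem_lt: "degree (x mod m i) < d" for x
        using degree_mod_less'[of "m i" x] m0[OF i] d1 by (cases "x mod m i = 0") (auto simp: d_def)
      have da: "degree a < d" and db: "degree b < d" unfolding a_def b_def by (rule rem_lt)+
      have dab: "degree (a * b) < 2 * d - 1"
        using degree_mult_le[of a b] da db by simp
      \<comment> \<open>The small algorithm multiplies remainders, so its product is that of \<open>p\<close> and \<open>q\<close> only
        modulo \<open>m i\<close>; the next reduction removes the ambiguity.\<close>
      have ab: "(a * b) mod m i = (p * q) mod m i" by (simp add: a_def b_def mod_mult_eq)
      have de: "degree (e i) < degree M"
        using degree_mod_less'[of M "Mi i * N i"] M0 s by (cases "e i = 0") (auto simp: e[OF i])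
      have dea: "degree (e i * ((p * q) mod m i)) < degree M + d - 1"
        using degree_mult_le[of "e i" "(p * q) mod m i"] de rem_lt[of "p * q"] by simp
      note cX' = cX[OF i, folded d_def] and cs' = cs[OF i, folded d_def]
      have Xf: "mod_reduction_mat (m i) (r - 1) *\<^sub>v f = coeff_vec d a"
        using mod_reduction_mat_mult_coeff_vec[OF m0[OF i], of p "r - 1"] p assms(2)
        by (simp add: d_def a_def)
      have Xg: "mod_reduction_mat (m i) (n - 1) *\<^sub>v g = coeff_vec d b"
        using mod_reduction_mat_mult_coeff_vec[OF m0[OF i], of q "n - 1"] q assms(1)
        by (simp add: d_def b_def)
      have Ff: "transpose_mat (?F i) *\<^sub>v f = transpose_mat (As i) *\<^sub>v coeff_vec d a"
        using cX'(1) cs'(1) f by (simp add: transpose_mult[of _ r d _ "R i"] assoc_mult_mat_vec[of _ "R i" d _ r] Xf[simplified])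
      have Gg: "transpose_mat (?G i) *\<^sub>v g = transpose_mat (Bs i) *\<^sub>v coeff_vec d b"
        using cX'(2) cs'(2) g by (simp add: transpose_mult[of _ n d _ "R i"] assoc_mult_mat_vec[of _ "R i" d _ n] Xg[simplified])
      let ?w = "component_mult (transpose_mat (As i) *\<^sub>v coeff_vec d a)
        (transpose_mat (Bs i) *\<^sub>v coeff_vec d b)"
      have w: "?w \<in> carrier_vec (R i)"
        using cs'(1,2) by (intro carrier_vecI) (simp add: dim_component_mult)
      have "\<forall>u \<in> carrier_vec d. \<forall>v \<in> carrier_vec d. lin_conv u v =
          Cs i *\<^sub>v component_mult (transpose_mat (As i) *\<^sub>v u) (transpose_mat (Bs i) *\<^sub>v v)"
        using small[OF i] unfolding bilinear_algorithm_def d_def by blast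
      then have "Cs i *\<^sub>v ?w = lin_conv (coeff_vec d a) (coeff_vec d b)"
        using coeff_vec_carrier by metis
      also have "\<dots> = coeff_vec (2 * d - 1) (a * b)"
        using lin_conv_coeff_vec[OF da db] by (simp add: mult_2)
      finally have 1: "Cs i *\<^sub>v ?w = coeff_vec (2 * d - 1) (a * b)" .
      \<comment> \<open>The index \<open>d\<close> of a reduction matrix is a degree bound, one less than the length of the
        vectors it takes; the subtraction of \<open>2\<close> is exact because \<open>d \<ge> 1\<close>.\<close>
      have len: "2 * d - 2 + 1 = 2 * d - 1" "degree M + d - 2 + 1 = degree M + d - 1"
        using d1 s by simp_all
      have 2: "mod_reduction_mat (m i) (2 * d - 2) *\<^sub>v coeff_vec (2 * d - 1) (a * b)
          = coeff_vec d ((p * q) mod m i)"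
        using mod_reduction_mat_mult_coeff_vec[OF m0[OF i], of "a * b" "2 * d - 2", unfolded len,
            OF dab]
        by (simp only: ab d_def)
      have 3: "toeplitz (coeff_vec (degree M) (e i)) d *\<^sub>v coeff_vec d ((p * q) mod m i)
          = coeff_vec (degree M + d - 1) (e i * ((p * q) mod m i))"
        using rem_lt by (intro toeplitz_mult_coeff_vec[OF de]) auto
      have 4: "mod_reduction_mat M (degree M + d - 2) *\<^sub>v
            coeff_vec (degree M + d - 1) (e i * ((p * q) mod m i))
          = coeff_vec (n + r - 1) ((e i * ((p * q) mod m i)) mod M)"
        using mod_reduction_mat_mult_coeff_vec[OF M0, of "e i * ((p * q) mod m i)"
            "degree M + d - 2", unfolded len, OF dea]
        by (simp only: deg_M)
      let ?X = "mod_reduction_mat M (degree M + d - 2)"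
      let ?T = "toeplitz (coeff_vec (degree M) (e i)) d"
      let ?Y = "mod_reduction_mat (m i) (2 * d - 2)"
      have "Ct i *\<^sub>v ?w = ?X *\<^sub>v (?T *\<^sub>v (?Y *\<^sub>v (Cs i *\<^sub>v ?w)))"
      proof -
        have XT: "?X * ?T \<in> carrier_mat (n + r - 1) d" using cX'(4,5) by simp
        have XTY: "?X * ?T * ?Y \<in> carrier_mat (n + r - 1) (2 * d - 1)" using XT cX'(3) by simp
        have Cw: "Cs i *\<^sub>v ?w \<in> carrier_vec (2 * d - 1)" using cs'(3) w by simp
        have YCw: "?Y *\<^sub>v (Cs i *\<^sub>v ?w) \<in> carrier_vec d" using cX'(3) Cw by simp
        show ?thesis
          unfolding Ct[OF i, folded d_def] assoc_mult_mat_vec[OF XTY cs'(3) w]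
            assoc_mult_mat_vec[OF XT cX'(3) Cw] assoc_mult_mat_vec[OF cX'(4,5) YCw] ..
      qed
      then show ?thesis by (simp only: Ff Gg 1 2 3 4)
    qed
    have "C *\<^sub>v component_mult (transpose_mat A *\<^sub>v f) (transpose_mat B *\<^sub>v g)
        = coeff_vec (n + r - 1) (\<Sum>i\<leftarrow>[1..<k + 1]. (e i * ((p * q) mod m i)) mod M)"
      unfolding A B C
      by (rule hconcat_bilinear_sum[OF f g, where R = R]; unfold ks)
        (fact cF cG cH block)+
    also have "(\<Sum>i\<leftarrow>[1..<k + 1]. (e i * ((p * q) mod m i)) mod M)
        = (\<Sum>i = 1..k. (e i * ((p * q) mod m i)) mod M)"
      by (simp only: sum_list_distinct_conv_sum_set[OF distinct_upt] ks)
    also have "\<dots> = p * q"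
    proof (rule chinese_remainder_reconstruction[where m = m and N = N and n' = n'])
      show "(M div m i) * N i + m i * n' i = 1" "e i = ((M div m i) * N i) mod M" if "i \<in> {1..k}" for i
        using bezout[OF that] e[OF that] Mi[OF that] by simp_all
    qed (use coprime_m M s in simp_all)
    finally show ?thesis
      using lin_conv_coeff_vec[OF p(1) q(1)] p(2) q(2) by simp
  qed
  then show ?thesis
    unfolding bilinear_algorithm_def using carriers by blast
qed

end
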